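(* There exist absolute constants $C>0$ and $c>0$ such that the following holds. Let $S$ be a collection of $n$ bi-infinite $x$-monotone curves in general position with $tn$ touching pairs, where $t>C$. Then the number of crossing points between the elements of $S$ is at least $c\, nt\sqrt{\log t/\log\log t}$.
   Context: A bi-infinite $x$-monotone curve is the graph of a continuous function $f:\mathbb{R}\to\mathbb{R}$. A family of curves is in general position if no three curves pass through the same point and no two curves share infinitely many points. Two curves touch (form a touching pair) if they have precisely one point in common, at which they do not properly cross; this point is a touching point. All other common points of two curves are crossing points. *)

theory Defs
  imports Complex_Main
begin

text \<open>A bi-infinite \<open>x\<close>-monotone curve is represented by the continuous function of which it is
  the graph. Distinct functions have distinct graphs, so a set of functions is a set of curves.\<close>

definition curve :: "(real \<Rightarrow> real) \<Rightarrow> (real \<times> real) set" where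
  "curve f = range (\<lambda>x. (x, f x))"

text \<open>No curve occurs twice in a family in general position, since two equal curves would share
  infinitely many points. Hence nothing is lost by taking families to be sets.\<close>

definition general_position :: "(real \<Rightarrow> real) set \<Rightarrow> bool" where
  "general_position S \<longleftrightarrow>
     (\<forall>f\<in>S. \<forall>g\<in>S. \<forall>h\<in>S. f \<noteq> g \<and> g \<noteq> h \<and> f \<noteq> h \<longrightarrow> curve f \<inter> curve g \<inter> curve h = {}) \<and>
     (\<forall>f\<in>S. \<forall>g\<in>S. f \<noteq> g \<longrightarrow> finite (curve f \<inter> curve g))"

definition properly_cross_at :: "(real \<Rightarrow> real) \<Rightarrow> (real \<Rightarrow> real) \<Rightarrow> real \<times> real \<Rightarrow> bool" where
  "properly_cross_at f g p \<longleftrightarrow> p \<in> curve f \<inter> curve g \<and>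
     ((\<forall>\<^sub>F x in at_left (fst p). f x < g x) \<and> (\<forall>\<^sub>F x in at_right (fst p). g x < f x) \<or>
      (\<forall>\<^sub>F x in at_left (fst p). g x < f x) \<and> (\<forall>\<^sub>F x in at_right (fst p). f x < g x))"

definition touching_point :: "(real \<Rightarrow> real) \<Rightarrow> (real \<Rightarrow> real) \<Rightarrow> real \<times> real \<Rightarrow> bool" where
  "touching_point f g p \<longleftrightarrow> curve f \<inter> curve g = {p} \<and> \<not> properly_cross_at f g p"

definition touch :: "(real \<Rightarrow> real) \<Rightarrow> (real \<Rightarrow> real) \<Rightarrow> bool" where
  "touch f g \<longleftrightarrow> (\<exists>p. touching_point f g p)"

definition touching_pairs :: "(real \<Rightarrow> real) set \<Rightarrow> (real \<Rightarrow> real) set set" where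
  "touching_pairs S = {{f, g} | f g. f \<in> S \<and> g \<in> S \<and> f \<noteq> g \<and> touch f g}"

text \<open>A common point of two curves that meet more than once is a crossing point even if the
  curves do not properly cross there.\<close>

definition crossing_points :: "(real \<Rightarrow> real) set \<Rightarrow> (real \<times> real) set" where
  "crossing_points S =
     {p. \<exists>f\<in>S. \<exists>g\<in>S. f \<noteq> g \<and> p \<in> curve f \<inter> curve g \<and> \<not> touching_point f g p}"

end

theory Submission
  imports Defs "HOL-Analysis.Convex" "HOL-Real_Asymp.Real_Asymp"
begin

text \<open>If two curves touch, one of them lies above the other. Two curves \<open>a, a'\<close> resting on the same
  curve \<open>b\<close> at \<open>u < v\<close> cross at some \<open>z\<close> between \<open>u\<close> and \<open>v\<close>; call \<open>(b, u, v)\<close> an arch with apex \<open>z\<close>.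
  Let \<open>T\<close> be the number of touchings and \<open>\<kappa> T\<close> the number of crossings. There are about \<open>T L\<close> arches
  with \<open>v\<close> at most \<open>L\<close> touchings away from \<open>u\<close> along \<open>b\<close>, so a typical apex is shared by \<open>L / \<kappa>\<close>
  curves \<open>b\<close>. Two curves \<open>b, b'\<close> that share an apex \<open>z\<close> cross both to the left and to the right of
  \<open>z\<close>; the two crossings of \<open>b\<close> and \<open>b'\<close> closest to \<open>z\<close> bound a lens, and the pair is charged to the
  left end of that lens. An end receives \<open>O(L\<^sup>2)\<close> charges, so \<open>\<Omega>(T / \<kappa>)\<close> crossings are charged.

  Within a constant power of \<open>\<kappa>\<close>, the number of crossings along a lens determines \<open>L\<close>: it is at most
  of order \<open>\<kappa> L\<close> because \<open>u\<close> and \<open>v\<close> are close, and at least of order \<open>L / \<kappa>\<close> because \<open>L / \<kappa>\<close>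
  different curves cross \<open>b\<close> there. Hence scales \<open>L\<close> that differ by a factor of order \<open>\<kappa>\<^sup>2\<close> charge
  disjoint sets of crossings. If the touching density \<open>t\<close> exceeds \<open>\<kappa>\<close> to the power \<open>O(\<kappa>\<^sup>2)\<close> there are
  enough scales to produce more than \<open>\<kappa> T\<close> crossings.\<close>

section \<open>Ranks and nearby pairs in finite linear orders\<close>

text \<open>All elements in question lie above the least of them, whose own upper rank is at most
  \<open>m\<close>.\<close>

lemma card_upper_ranks_le:
  fixes B :: "'a::linorder set"
  assumes "finite B"
  shows "card {x\<in>B. card {y\<in>B. x \<le> y} \<le> m} \<le> m"
proof (cases "{x\<in>B. card {y\<in>B. x \<le> y} \<le> m} = {}")
  case False
  define C where "C = {x\<in>B. card {y\<in>B. x \<le> y} \<le> m}"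
  have C: "finite C" "C \<noteq> {}" using assms False by (auto simp: C_def)
  then have "Min C \<in> C" by simp
  then have "card {y\<in>B. Min C \<le> y} \<le> m" by (simp add: C_def)
  moreover have "C \<subseteq> {y\<in>B. Min C \<le> y}" using C by (auto simp: C_def)
  ultimately have "card C \<le> m" using card_mono[of "{y\<in>B. Min C \<le> y}" C] assms by fastforce
  then show ?thesis by (simp add: C_def)
qed (simp only: card.empty)

lemma card_lower_ranks_le:
  fixes B :: "'a::linorder set"
  assumes "finite B"
  shows "card {x\<in>B. card {y\<in>B. y \<le> x} \<le> m} \<le> m"
proof (cases "{x\<in>B. card {y\<in>B. y \<le> x} \<le> m} = {}")
  case False
  define C where "C = {x\<in>B. card {y\<in>B. y \<le> x} \<le> m}"
  have C: "finite C" "C \<noteq> {}" using assms False by (auto simp: C_def)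
  then have "Max C \<in> C" by simp
  then have "card {y\<in>B. y \<le> Max C} \<le> m" by (simp add: C_def)
  moreover have "C \<subseteq> {y\<in>B. y \<le> Max C}" using C by (auto simp: C_def)
  ultimately have "card C \<le> m" using card_mono[of "{y\<in>B. y \<le> Max C}" C] assms by fastforce
  then show ?thesis by (simp add: C_def)
qed (simp only: card.empty)

text \<open>If some element has rank above \<open>m\<close>, the least such element has at least
  \<open>m\<close> elements strictly below it, and all of these have rank at most
  \<open>m\<close>.\<close>

lemma card_lower_ranks_ge:
  fixes B :: "'a::linorder set"
  assumes "finite B" "m \<le> card B"
  shows "m \<le> card {x\<in>B. card {y\<in>B. y \<le> x} \<le> m}"
proof (cases "{x\<in>B. m < card {y\<in>B. y \<le> x}} = {}")
  case True
  then have "{x\<in>B. card {y\<in>B. y \<le> x} \<le> m} = B" by auto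
  then show ?thesis using assms by simp
next
  case False
  define C where "C = {x\<in>B. m < card {y\<in>B. y \<le> x}}"
  have C: "finite C" "C \<noteq> {}" using assms False by (auto simp: C_def)
  then have M: "Min C \<in> C" by simp
  have "{y\<in>B. y \<le> Min C} = insert (Min C) {y\<in>B. y < Min C}"
    using M by (auto simp: C_def)
  moreover have "m < card {y\<in>B. y \<le> Min C}" using M by (simp add: C_def)
  ultimately have "m \<le> card {y\<in>B. y < Min C}" using assms by simp
  moreover have "{y\<in>B. y < Min C} \<subseteq> {x\<in>B. card {y\<in>B. y \<le> x} \<le> m}"
    using C Min_le[of C] by (force simp: C_def)
  ultimately show ?thesis
    using card_mono[of "{x\<in>B. card {y\<in>B. y \<le> x} \<le> m}" "{y\<in>B. y < Min C}"] assms by fastforce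
qed

text \<open>The half-open interval counts \<open>u\<close> but not \<open>v\<close>, so its
  cardinality is the number of steps in \<open>A\<close> from \<open>u\<close> to
  \<open>v\<close>.\<close>

definition near_pairs :: "'a::linorder set \<Rightarrow> nat \<Rightarrow> ('a \<times> 'a) set" where
  "near_pairs A m = {(u, v). u \<in> A \<and> v \<in> A \<and> u < v \<and> card (A \<inter> {u..<v}) \<le> m}"

lemma finite_near_pairs: "finite A \<Longrightarrow> finite (near_pairs A m)"
  by (rule finite_subset[of _ "A \<times> A"]) (auto simp: near_pairs_def)

text \<open>All but at most \<open>m\<close> elements have at least \<open>m\<close> elements
  strictly above them, and each such element forms near pairs with the next
  \<open>m\<close>.\<close>

lemma card_near_pairs_ge:
  fixes A :: "'a::linorder set"
  assumes "finite A"
  shows "(card A - m) * m \<le> card (near_pairs A m)"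
proof -
  define G where "G = {u\<in>A. m < card {y\<in>A. u \<le> y}}"
  define V where "V u = {v\<in>{y\<in>A. u < y}. card {y\<in>{y\<in>A. u < y}. y \<le> v} \<le> m}" for u
  have "A - {u\<in>A. card {y\<in>A. u \<le> y} \<le> m} = G" by (auto simp: G_def)
  then have "card G = card A - card {u\<in>A. card {y\<in>A. u \<le> y} \<le> m}"
    using assms by (metis (no_types, lifting) card_Diff_subset finite_Collect_conjI mem_Collect_eq subsetI finite_subset)
  then have G: "card A - m \<le> card G" using card_upper_ranks_le[OF assms, of m] by linarith
  have V: "m \<le> card (V u)" if "u \<in> G" for u
  proof -
    have "{y\<in>A. u \<le> y} = insert u {y\<in>A. u < y}" using that by (auto simp: G_def)
    then have "m \<le> card {y\<in>A. u < y}" using that assms by (simp add: G_def)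
    then show ?thesis unfolding V_def by (intro card_lower_ranks_ge) (use assms in auto)
  qed
  have "(card A - m) * m \<le> card G * m" using G by simp
  also have "\<dots> \<le> (\<Sum>u\<in>G. card (V u))" using V sum_mono[of G "\<lambda>_. m"] by simp
  also have "\<dots> = card (Sigma G V)"
    by (rule card_SigmaI[symmetric]) (use assms in \<open>auto simp: G_def V_def\<close>)
  also have "\<dots> \<le> card (near_pairs A m)"
  proof (intro card_mono finite_near_pairs assms subsetI)
    fix p assume "p \<in> Sigma G V"
    then obtain u v where p: "p = (u, v)" "u \<in> A" "v \<in> A" "u < v"
        "card {y\<in>{y\<in>A. u < y}. y \<le> v} \<le> m" by (auto simp: G_def V_def)
    \<comment> \<open>Passing from \<open>u \<le> y < v\<close> to \<open>u < y \<le> v\<close>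
      trades \<open>u\<close> for \<open>v\<close>, which leaves the cardinality unchanged.\<close>
    have "insert v (A \<inter> {u..<v}) = insert u {y\<in>{y\<in>A. u < y}. y \<le> v}" using p by auto
    then have "card (A \<inter> {u..<v}) = card {y\<in>{y\<in>A. u < y}. y \<le> v}"
      using assms p card_insert_disjoint[of "A \<inter> {u..<v}" v]
        card_insert_disjoint[of "{y\<in>{y\<in>A. u < y}. y \<le> v}" u] by simp
    then show "p \<in> near_pairs A m" using p by (simp add: near_pairs_def)
  qed
  finally show ?thesis .
qed

text \<open>Such a pair has \<open>u\<close> among the last \<open>m\<close> elements up to
  \<open>x\<close> and \<open>v\<close> among the first \<open>m\<close> elements beyond it, so
  there are at most \<open>m\<close> choices for each.\<close>

lemma card_near_pairs_separated_le:
  fixes A :: "'a::linorder set"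
  assumes "finite A"
  shows "card {(u, v). (u, v) \<in> near_pairs A m \<and> u \<le> x \<and> x < v} \<le> m\<^sup>2"
proof -
  define P where "P = {u\<in>{y\<in>A. y \<le> x}. card {y\<in>{y\<in>A. y \<le> x}. u \<le> y} \<le> m}"
  define Q where "Q = {v\<in>{y\<in>A. x < y}. card {y\<in>{y\<in>A. x < y}. y \<le> v} \<le> m}"
  have "{(u, v). (u, v) \<in> near_pairs A m \<and> u \<le> x \<and> x < v} \<subseteq> P \<times> Q"
  proof clarify
    fix u v assume uv: "(u, v) \<in> near_pairs A m" "u \<le> x" "x < v"
    then have A: "u \<in> A" "v \<in> A" "card (A \<inter> {u..<v}) \<le> m" by (auto simp: near_pairs_def)
    have "card {y\<in>{y\<in>A. y \<le> x}. u \<le> y} \<le> card (A \<inter> {u..<v})"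
      by (rule card_mono) (use uv assms in auto)
    then have "u \<in> P" using A uv by (auto simp: P_def)
    have "card {y\<in>{y\<in>A. x < y}. y \<le> v} = card (insert v {y\<in>A. x < y \<and> y < v})"
      by (rule arg_cong[of _ _ card]) (use A uv in auto)
    also have "\<dots> = card (insert u {y\<in>A. x < y \<and> y < v})"
      using assms uv by (auto simp: card_insert_if)
    also have "\<dots> \<le> card (A \<inter> {u..<v})"
      by (rule card_mono) (use A uv assms in auto)
    finally have "v \<in> Q" using A uv by (auto simp: Q_def)
    with \<open>u \<in> P\<close> show "u \<in> P \<and> v \<in> Q" ..
  qed
  then have "card {(u, v). (u, v) \<in> near_pairs A m \<and> u \<le> x \<and> x < v} \<le> card (P \<times> Q)"
    by (rule card_mono[rotated]) (use assms in \<open>auto simp: P_def Q_def\<close>)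
  also have "\<dots> \<le> m * m"
    unfolding card_cartesian_product
    by (intro mult_mono) (use card_upper_ranks_le[of "{y\<in>A. y \<le> x}" m]
      card_lower_ranks_le[of "{y\<in>A. x < y}" m] assms in \<open>auto simp: P_def Q_def\<close>)
  finally show ?thesis by (simp add: power2_eq_square)
qed

section \<open>Counting by fibres\<close>

lemma card_le_fibre_bound:
  assumes "finite A" "finite B" "f ` A \<subseteq> B" "\<And>y. y \<in> B \<Longrightarrow> card {x\<in>A. f x = y} \<le> m"
  shows "card A \<le> m * card B"
proof -
  have "card A = (\<Sum>y\<in>B. card {x\<in>A. f x = y})"
    using sum.group[OF assms(1-3), of "\<lambda>_. 1::nat"] by simp
  also have "\<dots> \<le> (\<Sum>y\<in>B. m)" by (intro sum_mono assms)
  finally show ?thesis by (simp add: mult.commute)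
qed

text \<open>Cauchy-Schwarz applied to the fibre sizes; the collisions are ordered pairs and include
  the diagonal.\<close>

lemma card_square_le_collisions:
  assumes "finite A" "finite B" "f ` A \<subseteq> B"
  shows "(card A)\<^sup>2 \<le> card B * card {(x, y). x \<in> A \<and> y \<in> A \<and> f x = f y}"
proof -
  define F where "F y = {x\<in>A. f x = y}" for y
  have A: "card A = (\<Sum>y\<in>B. card (F y))"
    using sum.group[OF assms, of "\<lambda>_. 1::nat"] by (simp add: F_def)
  have "{(x, y). x \<in> A \<and> y \<in> A \<and> f x = f y} = (\<Union>z\<in>B. F z \<times> F z)"
    using assms(3) by (auto simp: F_def)
  also have "card \<dots> = (\<Sum>z\<in>B. card (F z \<times> F z))"
    by (rule card_UN_disjoint) (use assms in \<open>auto simp: F_def\<close>)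
  finally have E: "card {(x, y). x \<in> A \<and> y \<in> A \<and> f x = f y} = (\<Sum>z\<in>B. (card (F z))\<^sup>2)"
    by (simp add: card_cartesian_product power2_eq_square)
  have "(\<Sum>y\<in>B. real (card (F y)))\<^sup>2 \<le> (\<Sum>y\<in>B. (real (card (F y)))\<^sup>2) * real (card B)"
    by (rule sum_squared_le_sum_of_squares)
  then have "real ((card A)\<^sup>2) \<le> real (card B * card {(x, y). x \<in> A \<and> y \<in> A \<and> f x = f y})"
    unfolding A E by (simp add: mult.commute)
  then show ?thesis by (simp only: of_nat_le_iff)
qed

section \<open>Common points and touchings of two continuous functions\<close>

lemma mem_curve_iff [simp]: "(x, y) \<in> curve f \<longleftrightarrow> y = f x"
  by (auto simp: curve_def)

lemma common_point_between:
  fixes f g :: "real \<Rightarrow> real"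
  assumes "continuous_on UNIV f" "continuous_on UNIV g" "f u < g u" "g v < f v"
  shows "\<exists>x. min u v < x \<and> x < max u v \<and> f x = g x"
proof -
  have c: "continuous_on A (\<lambda>x. f x - g x)" for A
    using assms(1,2) by (intro continuous_on_diff) (auto intro: continuous_on_subset)
  have "\<exists>x. min u v \<le> x \<and> x \<le> max u v \<and> f x - g x = 0"
  proof (cases "u \<le> v")
    case True
    then show ?thesis using IVT'[of "\<lambda>x. f x - g x" u 0 v] c assms by auto
  next
    case False
    then show ?thesis using IVT2'[of "\<lambda>x. f x - g x" u 0 v] c assms by auto
  qed
  then obtain x where x: "min u v \<le> x" "x \<le> max u v" "f x - g x = 0" by blast
  then have "x \<noteq> u" "x \<noteq> v" using assms by auto
  with x show ?thesis by (intro exI[of _ x]) (auto simp: min_def max_def split: if_splits)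
qed

text \<open>If \<open>p\<close> were the only common point, the intermediate value theorem would fix
  the sign of \<open>f - g\<close> on each side of it, and the opposite signs at \<open>u\<close>
  and \<open>v\<close> would make \<open>p\<close> a proper crossing.\<close>

lemma not_touching_point_if_both_orders:
  assumes "continuous_on UNIV f" "continuous_on UNIV g" "f u < g u" "g v < f v"
  shows "\<not> touching_point f g p"
proof
  assume t: "touching_point f g p"
  obtain x y where p: "p = (x, y)" by fastforce
  have only: "w = x" if "f w = g w" for w
  proof -
    have "(w, f w) \<in> curve f \<inter> curve g" using that by simp
    then have "(w, f w) \<in> {p}" using t unfolding touching_point_def by metis
    then show ?thesis by (simp add: p)
  qed
  have order: "min a b < x \<and> x < max a b" if "f a < g a" "g b < f b" for a b
    using common_point_between[OF assms(1,2) that] only by blast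
  have side: "f w < g w \<or> g w < f w" if "w \<noteq> x" for w
    using only[of w] that by linarith
  have pc: "p \<in> curve f \<inter> curve g" using t by (auto simp: touching_point_def)
  have "properly_cross_at f g p"
  proof (cases "u < v")
    case True
    then have "u < x" "x < v" using order[OF assms(3,4)] by auto
    have "f w < g w" if "w < x" for w
      using side[of w] order[OF assms(3), of w] \<open>u < x\<close> that by auto
    moreover have "g w < f w" if "x < w" for w
      using side[of w] order[OF _ assms(4), of w] \<open>x < v\<close> that by auto
    ultimately show ?thesis
      using pc unfolding properly_cross_at_def p by (simp add: eventually_at_filter)
  next
    case False
    then have "v < x" "x < u" using order[OF assms(3,4)] by auto
    have "f w < g w" if "x < w" for w
      using side[of w] order[OF assms(3), of w] \<open>x < u\<close> that by auto
    moreover have "g w < f w" if "w < x" for w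
      using side[of w] order[OF _ assms(4), of w] \<open>v < x\<close> that by auto
    ultimately show ?thesis
      using pc unfolding properly_cross_at_def p by (simp add: eventually_at_filter)
  qed
  with t show False by (simp add: touching_point_def)
qed

text \<open>Touching with an orientation: \<open>a\<close> is the upper curve.\<close>

definition rests_on :: "(real \<Rightarrow> real) \<Rightarrow> (real \<Rightarrow> real) \<Rightarrow> real \<Rightarrow> bool" where
  "rests_on a b x \<longleftrightarrow> a \<noteq> b \<and> (\<forall>y. b y \<le> a y) \<and> {y. a y = b y} = {x}"

lemma touch_imp_rests_on:
  assumes "continuous_on UNIV f" "continuous_on UNIV g" "touch f g" "f \<noteq> g"
  shows "\<exists>x. rests_on f g x \<or> rests_on g f x"
proof -
  obtain p where p: "touching_point f g p" using assms(3) by (auto simp: touch_def)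
  then have "(\<forall>y. g y \<le> f y) \<or> (\<forall>y. f y \<le> g y)"
    using not_touching_point_if_both_orders[OF assms(1,2)] by (meson not_le)
  moreover have "{y. f y = g y} = {fst p}"
  proof -
    have "(y, f y) = p" if "f y = g y" for y
    proof -
      have "(y, f y) \<in> curve f \<inter> curve g" using that by simp
      then have "(y, f y) \<in> {p}" using p unfolding touching_point_def by metis
      then show ?thesis by simp
    qed
    moreover have "f (fst p) = g (fst p)"
    proof -
      have "(fst p, snd p) \<in> curve f \<inter> curve g" using p by (simp add: touching_point_def)
      then show ?thesis by (cases p) simp
    qed
    ultimately show ?thesis by force
  qed
  moreover have "{y. g y = f y} = {y. f y = g y}" by auto
  ultimately have "rests_on f g (fst p) \<or> rests_on g f (fst p)"
    using assms(4) unfolding rests_on_def by simp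
  then show ?thesis by blast
qed

section \<open>Families in general position: crossing incidences and touchings\<close>

locale curve_family =
  fixes S :: "(real \<Rightarrow> real) set"
  assumes finite_S: "finite S"
    and cont: "f \<in> S \<Longrightarrow> continuous_on UNIV f"
    and gp: "general_position S"
begin

lemma no_three_concurrent:
  assumes "f \<in> S" "g \<in> S" "h \<in> S" "f \<noteq> g" "f x = g x" "f x = h x"
  shows "h = f \<or> h = g"
proof (rule ccontr)
  assume "\<not> ?thesis"
  then have "curve f \<inter> curve g \<inter> curve h = {}" using assms gp by (auto simp: general_position_def)
  moreover have "(x, f x) \<in> curve f \<inter> curve g \<inter> curve h" using assms by (auto simp: curve_def)
  ultimately show False by blast
qed

lemma finite_common:
  assumes "f \<in> S" "g \<in> S" "f \<noteq> g"
  shows "finite {x. f x = g x}"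
proof -
  have "finite (curve f \<inter> curve g)" using assms gp by (auto simp: general_position_def)
  then have "finite (fst ` (curve f \<inter> curve g))" by simp
  moreover have "{x. f x = g x} \<subseteq> fst ` (curve f \<inter> curve g)"
  proof
    fix x assume "x \<in> {x. f x = g x}"
    then have "(x, f x) \<in> curve f \<inter> curve g" by simp
    then show "x \<in> fst ` (curve f \<inter> curve g)" by (rule image_eqI[rotated]) simp
  qed
  ultimately show ?thesis by (rule rev_finite_subset)
qed

definition crossings_on :: "(real \<Rightarrow> real) \<Rightarrow> real set" where
  "crossings_on b = {x. (x, b x) \<in> crossing_points S}"

definition upper_touches :: "(real \<Rightarrow> real) \<Rightarrow> real set" where
  "upper_touches b = {x. \<exists>a\<in>S. rests_on a b x}"

definition crossing_incidences :: "((real \<Rightarrow> real) \<times> real) set" where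
  "crossing_incidences = Sigma S crossings_on"

lemma finite_crossing_points: "finite (crossing_points S)"
proof -
  have "crossing_points S \<subseteq> (\<Union>f\<in>S. \<Union>g\<in>S - {f}. curve f \<inter> curve g)"
    by (auto simp: crossing_points_def)
  moreover have "finite \<dots>"
    by (intro finite_UN_I) (use finite_S gp in \<open>auto simp: general_position_def\<close>)
  ultimately show ?thesis by (rule finite_subset)
qed

lemma finite_crossings_on [simp]: "finite (crossings_on b)"
proof -
  have "crossings_on b \<subseteq> fst ` crossing_points S"
    unfolding crossings_on_def by (auto intro: image_eqI[rotated])
  then show ?thesis using finite_crossing_points finite_surj by blast
qed

lemma finite_upper_touches [simp]: "finite (upper_touches b)"
proof -
  have "upper_touches b \<subseteq> (\<lambda>a. THE x. rests_on a b x) ` S"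
  proof
    fix x assume "x \<in> upper_touches b"
    then obtain a where a: "a \<in> S" "rests_on a b x" by (auto simp: upper_touches_def)
    then have "(THE x. rests_on a b x) = x" by (intro the_equality) (auto simp: rests_on_def)
    with a show "x \<in> (\<lambda>a. THE x. rests_on a b x) ` S" by force
  qed
  then show ?thesis using finite_S finite_surj by blast
qed

lemma finite_crossing_incidences [simp]: "finite crossing_incidences"
  using finite_S by (simp add: crossing_incidences_def)

text \<open>By general position only two curves pass through a crossing point.\<close>

lemma card_crossing_incidences_le: "card crossing_incidences \<le> 2 * card (crossing_points S)"
proof (rule card_le_fibre_bound[where f = "\<lambda>(b, x). (x, b x)"])
  show "(\<lambda>(b, x). (x, b x)) ` crossing_incidences \<subseteq> crossing_points S"
    by (auto simp: crossing_incidences_def crossings_on_def)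
  fix p assume "p \<in> crossing_points S"
  then obtain f g where fg: "f \<in> S" "g \<in> S" "f \<noteq> g" "p \<in> curve f \<inter> curve g"
    by (auto simp: crossing_points_def)
  then have "{i\<in>crossing_incidences. (case i of (b, x) \<Rightarrow> (x, b x)) = p} \<subseteq> {(f, fst p), (g, fst p)}"
    using no_three_concurrent[of f g] by (cases p) (auto simp: crossing_incidences_def, metis)
  then have "card {i\<in>crossing_incidences. (case i of (b, x) \<Rightarrow> (x, b x)) = p}
      \<le> card {(f, fst p), (g, fst p)}"
    by (intro card_mono) auto
  also have "\<dots> \<le> 2" by (simp add: card_insert_if)
  finally show "card {i\<in>crossing_incidences. (case i of (b, x) \<Rightarrow> (x, b x)) = p} \<le> 2" .
qed (simp_all add: finite_crossing_points)

text \<open>A touching pair is recovered from its lower curve and the touching abscissa: a second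
  curve resting there would put three curves through one point.\<close>

lemma card_touching_pairs_le: "card (touching_pairs S) \<le> (\<Sum>b\<in>S. card (upper_touches b))"
proof -
  let ?top = "\<lambda>b x. THE a. a \<in> S \<and> rests_on a b x"
  have top: "?top b x = a" if "b \<in> S" "a \<in> S" "rests_on a b x" for a b x
  proof (rule the_equality)
    fix a' assume a': "a' \<in> S \<and> rests_on a' b x"
    then have "b x = a' x" "b x = a x" "a \<noteq> b" "a' \<noteq> b" using that by (auto simp: rests_on_def)
    then show "a' = a" using no_three_concurrent[of b a a' x] that a' by auto
  qed (use that in auto)
  have "touching_pairs S \<subseteq> (\<lambda>(b, x). {b, ?top b x}) ` Sigma S upper_touches"
  proof
    fix P assume "P \<in> touching_pairs S"
    then obtain f g where fg: "P = {f, g}" "f \<in> S" "g \<in> S" "f \<noteq> g" "touch f g"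
      by (auto simp: touching_pairs_def)
    then obtain x where "rests_on f g x \<or> rests_on g f x"
      using touch_imp_rests_on cont by blast
    then obtain a b where ab: "P = {b, a}" "a \<in> S" "b \<in> S" "rests_on a b x" using fg by blast
    then have "(b, x) \<in> Sigma S upper_touches" by (auto simp: upper_touches_def)
    moreover have "P = {b, ?top b x}" using top[of b a x] ab by simp
    ultimately show "P \<in> (\<lambda>(b, x). {b, ?top b x}) ` Sigma S upper_touches"
      by (intro image_eqI[of _ _ "(b, x)"]) auto
  qed
  then have "card (touching_pairs S) \<le> card (Sigma S upper_touches)"
    by (rule surj_card_le[rotated]) (simp add: finite_S)
  then show ?thesis using finite_S by simp
qed

section \<open>Arches, linked arches and lenses\<close>

definition top_curve :: "(real \<Rightarrow> real) \<Rightarrow> real \<Rightarrow> real \<Rightarrow> real" where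
  "top_curve b u = (SOME a. a \<in> S \<and> rests_on a b u)"

lemma top_curve:
  assumes "u \<in> upper_touches b"
  shows "top_curve b u \<in> S" "rests_on (top_curve b u) b u"
  using someI_ex[of "\<lambda>a. a \<in> S \<and> rests_on a b u"] assms
  unfolding top_curve_def upper_touches_def by auto

lemma below_top_curve: "u \<in> upper_touches b \<Longrightarrow> b y \<le> top_curve b u y"
  and top_curve_eq_iff: "u \<in> upper_touches b \<Longrightarrow> top_curve b u y = b y \<longleftrightarrow> y = u"
  and top_curve_neq: "u \<in> upper_touches b \<Longrightarrow> top_curve b u \<noteq> b"
  using top_curve(2)[of u b] by (auto simp: rests_on_def)

text \<open>Two curves that occur in both orders do not touch, so each of their common points is a
  crossing point, even where they do not properly cross.\<close>

lemma crossings_onI: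
  assumes "f \<in> S" "g \<in> S" "f u < g u" "g v < f v" "f x = g x"
  shows "x \<in> crossings_on f" "x \<in> crossings_on g"
proof -
  have "(x, f x) \<in> curve f \<inter> curve g" using assms by simp
  moreover have "f \<noteq> g" using assms by auto
  ultimately show "x \<in> crossings_on f" "x \<in> crossings_on g"
    using not_touching_point_if_both_orders[OF cont cont, OF assms(1-4)] assms(1,2,5)
    unfolding crossings_on_def crossing_points_def mem_Collect_eq by metis+
qed

definition arch :: "(real \<Rightarrow> real) \<Rightarrow> real \<Rightarrow> real \<Rightarrow> bool" where
  "arch b u v \<longleftrightarrow> b \<in> S \<and> u \<in> upper_touches b \<and> v \<in> upper_touches b \<and> u < v"

text \<open>Each top curve meets \<open>b\<close> only at its own foot and lies strictly above
  \<open>b\<close> at the other one.\<close>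

lemma arch_top_curves_order:
  assumes "arch b u v"
  shows "top_curve b u u < top_curve b v u" "top_curve b v v < top_curve b u v"
  using assms below_top_curve[of v b u] below_top_curve[of u b v] top_curve_eq_iff[of u b u]
    top_curve_eq_iff[of v b v] top_curve_eq_iff[of u b v] top_curve_eq_iff[of v b u]
  by (auto simp: arch_def)

text \<open>The two top curves may meet several times between \<open>u\<close> and \<open>v\<close>;
  one meeting is fixed for each arch.\<close>

definition apex :: "(real \<Rightarrow> real) \<Rightarrow> real \<Rightarrow> real \<Rightarrow> real" where
  "apex b u v = (SOME z. u < z \<and> z < v \<and> top_curve b u z = top_curve b v z)"

lemma apex:
  assumes "arch b u v"
  shows "u < apex b u v" "apex b u v < v"
    "top_curve b u (apex b u v) = top_curve b v (apex b u v)"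
    "apex b u v \<in> crossings_on (top_curve b u)"
proof -
  have S: "top_curve b u \<in> S" "top_curve b v \<in> S" using assms top_curve by (auto simp: arch_def)
  have "\<exists>z. u < z \<and> z < v \<and> top_curve b u z = top_curve b v z"
    using common_point_between[OF cont[OF S(1)] cont[OF S(2)] arch_top_curves_order[OF assms]] assms
    by (auto simp: arch_def)
  from someI_ex[OF this] show "u < apex b u v" "apex b u v < v"
    and *: "top_curve b u (apex b u v) = top_curve b v (apex b u v)"
    unfolding apex_def by blast+
  show "apex b u v \<in> crossings_on (top_curve b u)"
    by (rule crossings_onI(1)[OF S arch_top_curves_order[OF assms] *])
qed

text \<open>The left top curve and the apex form the crossing incidence by which arches are grouped
  later; general position makes the right top curves agree as well.\<close>

definition linked :: "(real \<Rightarrow> real) \<Rightarrow> real \<Rightarrow> real \<Rightarrow> (real \<Rightarrow> real) \<Rightarrow> real \<Rightarrow> real \<Rightarrow> bool" where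
  "linked b u v b' u' v' \<longleftrightarrow> arch b u v \<and> arch b' u' v' \<and> top_curve b u = top_curve b' u' \<and>
     apex b u v = apex b' u' v'"

lemma linked_right_top_curve:
  assumes "linked b u v b' u' v'"
  shows "top_curve b v = top_curve b' v'"
proof -
  let ?z = "apex b u v"
  have a: "arch b u v" "arch b' u' v'" and e: "top_curve b u = top_curve b' u'" "apex b' u' v' = ?z"
    using assms by (auto simp: linked_def)
  have S: "top_curve b u \<in> S" "top_curve b v \<in> S" "top_curve b' v' \<in> S"
    using a top_curve by (auto simp: arch_def)
  have "top_curve b v \<noteq> top_curve b u" "top_curve b' v' \<noteq> top_curve b u"
    using arch_top_curves_order[OF a(1)] arch_top_curves_order[OF a(2)] e by auto
  moreover have "top_curve b u ?z = top_curve b v ?z" "top_curve b u ?z = top_curve b' v' ?z"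
    using apex(3)[OF a(1)] apex(3)[OF a(2)] e by auto
  ultimately show ?thesis using no_three_concurrent[OF S, of ?z] by auto
qed

text \<open>The arches share both top curves, and each of these rests on \<open>b\<close> at one
  point only.\<close>

lemma linked_same_base:
  assumes "linked b u v b u' v'"
  shows "u = u'" "v = v'"
proof -
  have "rests_on (top_curve b u) b u" "rests_on (top_curve b u) b u'"
    "rests_on (top_curve b v) b v" "rests_on (top_curve b v) b v'"
    using assms top_curve(2) linked_right_top_curve[OF assms]
    unfolding linked_def arch_def by metis+
  then show "u = u'" "v = v'" unfolding rests_on_def by blast+
qed

text \<open>At \<open>u\<close> the common top curve meets \<open>b\<close> and lies weakly above
  \<open>b'\<close>; equality would put three curves through one point.\<close>

lemma base_order_under_common_top:
  assumes "b \<in> S" "b' \<in> S" "b \<noteq> b'" "u \<in> upper_touches b" "u' \<in> upper_touches b'"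
    "top_curve b u = top_curve b' u'"
  shows "b' u < b u"
proof -
  have "b' u \<le> b u" using below_top_curve[OF assms(5), of u] top_curve_eq_iff[OF assms(4), of u] assms(6) by simp
  moreover have "b' u \<noteq> b u"
    using no_three_concurrent[of b b' "top_curve b u" u] assms top_curve(1)[OF assms(4)]
      top_curve_eq_iff[OF assms(4), of u] top_curve_neq[OF assms(4)] top_curve_neq[OF assms(5)] by auto
  ultimately show ?thesis by simp
qed

text \<open>The base curves may meet at the abscissa \<open>z\<close> itself. Such a point counts as
  a right end only, so the two ends are consecutive common points.\<close>

definition lens_left :: "(real \<Rightarrow> real) \<Rightarrow> (real \<Rightarrow> real) \<Rightarrow> real \<Rightarrow> real" where
  "lens_left b b' z = Max {x. x < z \<and> b x = b' x}"

definition lens_right :: "(real \<Rightarrow> real) \<Rightarrow> (real \<Rightarrow> real) \<Rightarrow> real \<Rightarrow> real" where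
  "lens_right b b' z = Min {x. z \<le> x \<and> b x = b' x}"

lemma lens_commute: "lens_left b b' = lens_left b' b" "lens_right b b' = lens_right b' b"
  by (auto simp: lens_left_def lens_right_def fun_eq_iff eq_commute)

text \<open>Where a common top curve rests on \<open>b\<close>, the curve \<open>b'\<close> is
  strictly lower, and conversely. Hence \<open>b\<close> and \<open>b'\<close> change order between
  \<open>u\<close> and \<open>u'\<close>, which is left of the apex, and between \<open>v\<close>
  and \<open>v'\<close>, which is right of it. By the last claim the two curves and the left end
  determine the right end, so lenses with equal charges can be compared.\<close>

lemma lens:
  assumes l: "linked b u v b' u' v'" and ne: "b \<noteq> b'"
  defines "z \<equiv> apex b u v"
  defines "q \<equiv> lens_left b b' z"
  defines "r \<equiv> lens_right b b' z"
  shows "q < z" "z \<le> r" "b q = b' q" "b r = b' r" "u < q \<or> u' < q" "r < v \<or> r < v'"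
    "q \<in> crossings_on b" "r \<in> crossings_on b" "r = Min {x. q < x \<and> b x = b' x}"
proof -
  have a: "arch b u v" "arch b' u' v'" "top_curve b u = top_curve b' u'" "apex b' u' v' = z"
    and S: "b \<in> S" "b' \<in> S"
    using l by (auto simp: linked_def arch_def z_def)
  have z: "u < z" "u' < z" "z < v" "z < v'"
    using apex(1,2)[OF a(1)] apex(1,2)[OF a(2)] a(4) by (auto simp: z_def)
  have o: "b' u < b u" "b u' < b' u'" "b' v < b v" "b v' < b' v'"
    using base_order_under_common_top[of b b' u u'] base_order_under_common_top[of b' b u' u]
      base_order_under_common_top[of b b' v v'] base_order_under_common_top[of b' b v' v]
      linked_right_top_curve[OF l] a ne by (auto simp: arch_def)
  have fin: "finite {x. x < z \<and> b x = b' x}" "finite {x. z \<le> x \<and> b x = b' x}"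
    by (rule finite_subset[OF _ finite_common[OF S ne]], blast)+
  obtain x where x: "min u' u < x" "x < max u' u" "b x = b' x"
    using common_point_between[OF cont[OF S(1)] cont[OF S(2)] o(2) o(1)] by blast
  obtain y where y: "min v' v < y" "y < max v' v" "b y = b' y"
    using common_point_between[OF cont[OF S(1)] cont[OF S(2)] o(4) o(3)] by blast
  have xz: "x < z" "z \<le> y" using x y z by (auto simp: max_def min_def split: if_splits)
  have "q \<in> {x. x < z \<and> b x = b' x}"
    unfolding q_def lens_left_def using Max_in[OF fin(1)] xz x by blast
  then show q: "q < z" "b q = b' q" by auto
  have "r \<in> {x. z \<le> x \<and> b x = b' x}"
    unfolding r_def lens_right_def using Min_in[OF fin(2)] xz y by blast
  then show r: "z \<le> r" "b r = b' r" by auto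
  have "x \<le> q" unfolding q_def lens_left_def using Max_ge[OF fin(1)] xz x by blast
  then show "u < q \<or> u' < q" using x by (auto simp: min_def split: if_splits)
  have "r \<le> y" unfolding r_def lens_right_def using Min_le[OF fin(2)] xz y by blast
  then show "r < v \<or> r < v'" using y by (auto simp: max_def split: if_splits)
  show "q \<in> crossings_on b" by (rule crossings_onI(1)[OF S o(2,1) q(2)])
  show "r \<in> crossings_on b" by (rule crossings_onI(1)[OF S o(2,1) r(2)])
  have "{x. z \<le> x \<and> b x = b' x} = {x. q < x \<and> b x = b' x}"
  proof (intro equalityI subsetI)
    fix w assume w: "w \<in> {x. q < x \<and> b x = b' x}"
    show "w \<in> {x. z \<le> x \<and> b x = b' x}"
    proof (rule ccontr)
      assume "w \<notin> {x. z \<le> x \<and> b x = b' x}"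
      then have "w \<le> q" unfolding q_def lens_left_def using Max_ge[OF fin(1)] w by simp
      with w show False by simp
    qed
  qed (use q in auto)
  then show "r = Min {x. q < x \<and> b x = b' x}" by (simp add: r_def lens_right_def)
qed

section \<open>Counting arches with few crossings\<close>

definition arches :: "nat \<Rightarrow> nat \<Rightarrow> ((real \<Rightarrow> real) \<times> real \<times> real) set" where
  "arches L U = {(b, u, v). b \<in> S \<and> (u, v) \<in> near_pairs (upper_touches b) L \<and>
     card (crossings_on b \<inter> {u..<v}) \<le> U}"

lemma arches_imp_arch: "(b, u, v) \<in> arches L U \<Longrightarrow> arch b u v"
  by (auto simp: arches_def near_pairs_def arch_def)

lemma finite_arches [simp]: "finite (arches L U)"
proof (rule finite_subset)
  show "arches L U \<subseteq> Sigma S (\<lambda>b. near_pairs (upper_touches b) L)" by (auto simp: arches_def)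
qed (simp add: finite_S finite_near_pairs)

text \<open>Double counting of near pairs with the crossings inside them: a heavy pair contains more
  than \<open>U\<close> crossings, and a crossing lies inside at most \<open>L\<^sup>2\<close> near
  pairs.\<close>

lemma card_heavy_near_pairs_le:
  "U * card {(u, v). (u, v) \<in> near_pairs (upper_touches b) L \<and> U < card (crossings_on b \<inter> {u..<v})}
     \<le> L\<^sup>2 * card (crossings_on b)"
proof -
  let ?P = "near_pairs (upper_touches b) L"
  let ?c = "\<lambda>(u, v). crossings_on b \<inter> {u..<v}"
  define H where "H = {(u, v). (u, v) \<in> ?P \<and> U < card (crossings_on b \<inter> {u..<v})}"
  have P: "finite ?P" by (simp add: finite_near_pairs)
  have H: "H \<subseteq> ?P" by (auto simp: H_def)
  have "U * card H \<le> (\<Sum>p\<in>H. card (?c p))"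
    using sum_mono[of H "\<lambda>_. U" "\<lambda>p. card (?c p)"] by (auto simp: H_def mult.commute)
  also have "\<dots> \<le> (\<Sum>p\<in>?P. card (?c p))" by (intro sum_mono2) (use P H in auto)
  also have "\<dots> = card (Sigma ?P ?c)" by (rule card_SigmaI[symmetric]) (use P in auto)
  also have "\<dots> \<le> L\<^sup>2 * card (crossings_on b)"
  proof (rule card_le_fibre_bound[where f = snd])
    fix x
    have "{p\<in>Sigma ?P ?c. snd p = x} \<subseteq> (\<lambda>p. (p, x)) ` {(u, v). (u, v) \<in> ?P \<and> u \<le> x \<and> x < v}"
      by auto
    then have "card {p\<in>Sigma ?P ?c. snd p = x} \<le> card {(u, v). (u, v) \<in> ?P \<and> u \<le> x \<and> x < v}"
      by (rule surj_card_le[rotated]) (rule finite_subset[OF _ P], auto)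
    also have "\<dots> \<le> L\<^sup>2" by (rule card_near_pairs_separated_le) simp
    finally show "card {p\<in>Sigma ?P ?c. snd p = x} \<le> L\<^sup>2" .
  qed (use P in auto)
  finally show ?thesis by (simp add: H_def)
qed

text \<open>Let \<open>T\<close> be the sum in the conclusion. There are at least
  \<open>T * L - card S * L\<^sup>2 \<ge> T * L / 2\<close> near pairs, and by the choice of
  \<open>U\<close> at most \<open>L\<^sup>2 * \<kappa> * T / U = T * L / 4\<close> of them are
  heavy.\<close>

lemma card_arches_ge:
  assumes "U = 4 * \<kappa> * L" "\<kappa> > 0" "L > 0"
    "2 * card S * L \<le> (\<Sum>b\<in>S. card (upper_touches b))"
    "card crossing_incidences \<le> \<kappa> * (\<Sum>b\<in>S. card (upper_touches b))"
  shows "(\<Sum>b\<in>S. card (upper_touches b)) * L \<le> 4 * card (arches L U)"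
proof -
  let ?P = "\<lambda>b. near_pairs (upper_touches b) L"
  let ?H = "\<lambda>b. {(u, v). (u, v) \<in> ?P b \<and> U < card (crossings_on b \<inter> {u..<v})}"
  let ?G = "\<lambda>b. {(u, v). (u, v) \<in> ?P b \<and> card (crossings_on b \<inter> {u..<v}) \<le> U}"
  define T where "T = (\<Sum>b\<in>S. card (upper_touches b))"
  have fin: "finite (?G b)" "finite (?H b)" for b
    by (rule finite_subset[of _ "?P b"]; force simp: finite_near_pairs)+
  have "arches L U = Sigma S ?G" by (auto simp: arches_def)
  then have D: "card (arches L U) = (\<Sum>b\<in>S. card (?G b))" using finite_S fin by simp
  have split: "card (?P b) = card (?G b) + card (?H b)" for b
  proof -
    have "card (?P b) = card (?G b \<union> ?H b)" by (rule arg_cong[of _ _ card]) auto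
    also have "\<dots> = card (?G b) + card (?H b)" by (rule card_Un_disjoint[OF fin]) auto
    finally show ?thesis .
  qed
  have "U * (\<Sum>b\<in>S. card (?H b)) \<le> (\<Sum>b\<in>S. L\<^sup>2 * card (crossings_on b))"
    unfolding sum_distrib_left by (intro sum_mono card_heavy_near_pairs_le)
  also have "\<dots> = L\<^sup>2 * card crossing_incidences"
    using finite_S by (simp add: crossing_incidences_def sum_distrib_left)
  also have "\<dots> \<le> L\<^sup>2 * (\<kappa> * T)" using assms(5) unfolding T_def by (rule mult_left_mono) simp
  finally have "(\<kappa> * L) * (4 * (\<Sum>b\<in>S. card (?H b))) \<le> (\<kappa> * L) * (L * T)"
    by (simp add: assms(1) power2_eq_square algebra_simps)
  then have H: "4 * (\<Sum>b\<in>S. card (?H b)) \<le> L * T" using assms(2,3) by simp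
  \<comment> \<open>For a curve with fewer than \<open>L\<close> upper touches the truncated
    difference is zero, and the added \<open>L * L\<close> covers its contribution.\<close>
  have "T * L \<le> (\<Sum>b\<in>S. (card (upper_touches b) - L) * L + L * L)"
    unfolding T_def sum_distrib_right
    by (intro sum_mono) (metis add_mult_distrib le_add_diff_inverse2 le_cases mult_le_mono1 trans_le_add2)
  also have "\<dots> \<le> (\<Sum>b\<in>S. card (?P b) + L * L)"
    by (intro sum_mono add_right_mono card_near_pairs_ge) simp
  also have "\<dots> = (\<Sum>b\<in>S. card (?P b)) + card S * L * L" by (simp add: sum.distrib)
  finally have "T * L \<le> (\<Sum>b\<in>S. card (?P b)) + card S * L * L" .
  moreover have "2 * (card S * L * L) \<le> T * L"
    using mult_right_mono[OF assms(4), of L] by (simp add: T_def algebra_simps)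
  ultimately have "T * L \<le> 2 * (\<Sum>b\<in>S. card (?P b))" by linarith
  also have "(\<Sum>b\<in>S. card (?P b)) = card (arches L U) + (\<Sum>b\<in>S. card (?H b))"
    by (simp only: split D sum.distrib)
  finally show ?thesis using H by (simp add: T_def[symmetric] mult.commute)
qed

section \<open>Pairs of arches with a common apex\<close>

definition linked_pairs ::
    "nat \<Rightarrow> nat \<Rightarrow> (((real \<Rightarrow> real) \<times> real \<times> real) \<times> ((real \<Rightarrow> real) \<times> real \<times> real)) set" where
  "linked_pairs L U = {((b, u, v), (b', u', v')). (b, u, v) \<in> arches L U \<and>
     (b', u', v') \<in> arches L U \<and> linked b u v b' u' v' \<and> b \<noteq> b'}"

lemma finite_linked_pairs [simp]: "finite (linked_pairs L U)"
  by (rule finite_subset[of _ "arches L U \<times> arches L U"]) (auto simp: linked_pairs_def)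

lemma linked_pairs_swap: "(d, d') \<in> linked_pairs L U \<Longrightarrow> (d', d) \<in> linked_pairs L U"
  by (auto simp: linked_pairs_def linked_def)

text \<open>Cauchy-Schwarz for the map from an arch to the incidence of its left top curve with its
  apex. Colliding arches are linked; those over the same base coincide and give the diagonal term
  \<open>card (arches L U)\<close>.\<close>

lemma card_arches_square_le:
  "(card (arches L U))\<^sup>2 \<le> card crossing_incidences * (card (linked_pairs L U) + card (arches L U))"
proof -
  define key where "key = (\<lambda>(b, u, v). (top_curve b u, apex b u v))"
  have "key ` arches L U \<subseteq> crossing_incidences"
    using apex(4) top_curve(1) arches_imp_arch
    by (fastforce simp: key_def crossing_incidences_def arch_def)
  then have "(card (arches L U))\<^sup>2 \<le> card crossing_incidences *
      card {(x, y). x \<in> arches L U \<and> y \<in> arches L U \<and> key x = key y}"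
    by (intro card_square_le_collisions) auto
  also have "{(x, y). x \<in> arches L U \<and> y \<in> arches L U \<and> key x = key y}
      \<subseteq> linked_pairs L U \<union> (\<lambda>x. (x, x)) ` arches L U"
  proof clarify
    fix b u v b' u' v'
    assume d: "(b, u, v) \<in> arches L U" "(b', u', v') \<in> arches L U" "key (b, u, v) = key (b', u', v')"
      "((b, u, v), (b', u', v')) \<notin> (\<lambda>x. (x, x)) ` arches L U"
    then have l: "linked b u v b' u' v'" using arches_imp_arch by (auto simp: linked_def key_def)
    moreover have "b \<noteq> b'"
    proof
      assume "b = b'"
      then have eq: "(b', u', v') = (b, u, v)" using linked_same_base[of b u v u' v'] l by simp
      show False using d(1,4) unfolding eq by blast
    qed
    ultimately show "((b, u, v), (b', u', v')) \<in> linked_pairs L U" using d by (simp add: linked_pairs_def)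
  qed
  then have "card {(x, y). x \<in> arches L U \<and> y \<in> arches L U \<and> key x = key y}
      \<le> card (linked_pairs L U \<union> (\<lambda>x. (x, x)) ` arches L U)"
    by (intro card_mono) auto
  also have "\<dots> \<le> card (linked_pairs L U) + card (arches L U)"
    by (metis (no_types, lifting) add_left_mono card_Un_le card_image_le finite_arches le_trans)
  finally show ?thesis by simp
qed

text \<open>By general position a common point with \<open>b\<close> identifies the partner curve;
  the two partner arches on it are then linked to each other, so their feet agree.\<close>

lemma linked_pairs_partner_unique:
  assumes "((b, u, v), (b1, u1, v1)) \<in> linked_pairs L U" "((b, u, v), (b2, u2, v2)) \<in> linked_pairs L U"
    "b x = b1 x" "b x = b2 x"
  shows "b1 = b2" "u1 = u2" "v1 = v2"
proof -
  have l: "linked b u v b1 u1 v1" "linked b u v b2 u2 v2" "b \<noteq> b1" "b \<noteq> b2"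
    using assms by (auto simp: linked_pairs_def)
  then have "b \<in> S" "b1 \<in> S" "b2 \<in> S" by (auto simp: linked_def arch_def)
  then show e: "b1 = b2" using no_three_concurrent[of b b1 b2 x] l(3,4) assms(3,4) by metis
  have "linked b1 u1 v1 b1 u2 v2" using l e by (auto simp: linked_def)
  then show "u1 = u2" "v1 = v2" by (rule linked_same_base)+
qed

text \<open>By general position a crossing on \<open>b\<close> determines the other curve, and at most \<open>l\<close> crossings on
  \<open>b\<close> are within \<open>l\<close> steps of the apex on a given side.\<close>

lemma card_short_left_le:
  "card {((b, u, v), (b', u', v')). ((b, u, v), (b', u', v')) \<in> linked_pairs L U \<and>
      card (crossings_on b \<inter> {lens_left b b' (apex b u v)..<apex b u v}) \<le> l} \<le> l * card (arches L U)"
  (is "card ?B \<le> _")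
proof (rule card_le_fibre_bound[where f = fst])
  show "finite ?B" by (rule finite_subset[OF _ finite_linked_pairs[of L U]]) auto
  show "fst ` ?B \<subseteq> arches L U" by (auto simp: linked_pairs_def)
  fix d assume "d \<in> arches L U"
  obtain b u v where d: "d = (b, u, v)" by (cases d)
  define z where "z = apex b u v"
  define A where "A = {x\<in>crossings_on b. x < z}"
  define f :: "((real \<Rightarrow> real) \<times> real \<times> real) \<times> ((real \<Rightarrow> real) \<times> real \<times> real) \<Rightarrow> real"
    where "f e = lens_left b (fst (snd e)) z" for e
  have "card {e\<in>?B. fst e = d} \<le> card {x\<in>A. card {y\<in>A. x \<le> y} \<le> l}"
  proof (rule card_inj_on_le)
    show "inj_on f {e\<in>?B. fst e = d}"
    proof (rule inj_onI)
      fix e1 e2 assume "e1 \<in> {e\<in>?B. fst e = d}" "e2 \<in> {e\<in>?B. fst e = d}" and f: "f e1 = f e2"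
      then obtain b1 u1 v1 b2 u2 v2 where e: "e1 = ((b, u, v), (b1, u1, v1))" "e2 = ((b, u, v), (b2, u2, v2))"
        and l: "((b, u, v), (b1, u1, v1)) \<in> linked_pairs L U" "((b, u, v), (b2, u2, v2)) \<in> linked_pairs L U"
        using d by auto
      then have x: "b (f e1) = b1 (f e1)" "b (f e1) = b2 (f e1)"
        using lens(3)[of b u v b1 u1 v1] lens(3)[of b u v b2 u2 v2] f
        by (auto simp: linked_pairs_def f_def z_def)
      show "e1 = e2" unfolding e using linked_pairs_partner_unique[OF l x] by blast
    qed
    show "f ` {e\<in>?B. fst e = d} \<subseteq> {x\<in>A. card {y\<in>A. x \<le> y} \<le> l}"
    proof (rule image_subsetI)
      fix e assume "e \<in> {e\<in>?B. fst e = d}"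
      then obtain b' u' v' where e: "e = (d, b', u', v')" "((b, u, v), (b', u', v')) \<in> linked_pairs L U"
        and c: "card (crossings_on b \<inter> {lens_left b b' z..<z}) \<le> l" using d by (auto simp: z_def)
      have "{y\<in>A. lens_left b b' z \<le> y} = crossings_on b \<inter> {lens_left b b' z..<z}" by (auto simp: A_def)
      moreover have "lens_left b b' z \<in> A"
        using lens(1,7)[of b u v b' u' v'] e by (auto simp: linked_pairs_def A_def z_def)
      ultimately show "f e \<in> {x\<in>A. card {y\<in>A. x \<le> y} \<le> l}" using c e by (simp add: f_def)
    qed
  qed (simp add: A_def)
  also have "\<dots> \<le> l" by (rule card_upper_ranks_le) (simp add: A_def)
  finally show "card {e\<in>?B. fst e = d} \<le> l" .
qed simp

lemma card_short_right_le:
  "card {((b, u, v), (b', u', v')). ((b, u, v), (b', u', v')) \<in> linked_pairs L U \<and>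
      card (crossings_on b \<inter> {apex b u v..lens_right b b' (apex b u v)}) \<le> l} \<le> l * card (arches L U)"
  (is "card ?B \<le> _")
proof (rule card_le_fibre_bound[where f = fst])
  show "finite ?B" by (rule finite_subset[OF _ finite_linked_pairs[of L U]]) auto
  show "fst ` ?B \<subseteq> arches L U" by (auto simp: linked_pairs_def)
  fix d assume "d \<in> arches L U"
  obtain b u v where d: "d = (b, u, v)" by (cases d)
  define z where "z = apex b u v"
  define A where "A = {x\<in>crossings_on b. z \<le> x}"
  define f :: "((real \<Rightarrow> real) \<times> real \<times> real) \<times> ((real \<Rightarrow> real) \<times> real \<times> real) \<Rightarrow> real"
    where "f e = lens_right b (fst (snd e)) z" for e
  have "card {e\<in>?B. fst e = d} \<le> card {x\<in>A. card {y\<in>A. y \<le> x} \<le> l}"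
  proof (rule card_inj_on_le)
    show "inj_on f {e\<in>?B. fst e = d}"
    proof (rule inj_onI)
      fix e1 e2 assume "e1 \<in> {e\<in>?B. fst e = d}" "e2 \<in> {e\<in>?B. fst e = d}" and f: "f e1 = f e2"
      then obtain b1 u1 v1 b2 u2 v2 where e: "e1 = ((b, u, v), (b1, u1, v1))" "e2 = ((b, u, v), (b2, u2, v2))"
        and l: "((b, u, v), (b1, u1, v1)) \<in> linked_pairs L U" "((b, u, v), (b2, u2, v2)) \<in> linked_pairs L U"
        using d by auto
      then have x: "b (f e1) = b1 (f e1)" "b (f e1) = b2 (f e1)"
        using lens(4)[of b u v b1 u1 v1] lens(4)[of b u v b2 u2 v2] f
        by (auto simp: linked_pairs_def f_def z_def)
      show "e1 = e2" unfolding e using linked_pairs_partner_unique[OF l x] by blast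
    qed
    show "f ` {e\<in>?B. fst e = d} \<subseteq> {x\<in>A. card {y\<in>A. y \<le> x} \<le> l}"
    proof (rule image_subsetI)
      fix e assume "e \<in> {e\<in>?B. fst e = d}"
      then obtain b' u' v' where e: "e = (d, b', u', v')" "((b, u, v), (b', u', v')) \<in> linked_pairs L U"
        and c: "card (crossings_on b \<inter> {z..lens_right b b' z}) \<le> l" using d by (auto simp: z_def)
      have "{y\<in>A. y \<le> lens_right b b' z} = crossings_on b \<inter> {z..lens_right b b' z}" by (auto simp: A_def)
      moreover have "lens_right b b' z \<in> A"
        using lens(2,8)[of b u v b' u' v'] e by (auto simp: linked_pairs_def A_def z_def)
      ultimately show "f e \<in> {x\<in>A. card {y\<in>A. y \<le> x} \<le> l}" using c e by (simp add: f_def)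
    qed
  qed (simp add: A_def)
  also have "\<dots> \<le> l" by (rule card_lower_ranks_le) (simp add: A_def)
  finally show "card {e\<in>?B. fst e = d} \<le> l" .
qed simp

section \<open>Wide lenses and the charging scheme\<close>

text \<open>All four halves must be long: lenses with the same ends may have different apexes, and
  it is not known in advance which half on which curve will be compared.\<close>

definition half_lenses_exceed :: "nat \<Rightarrow> (real \<Rightarrow> real) \<Rightarrow> (real \<Rightarrow> real) \<Rightarrow> real \<Rightarrow> bool" where
  "half_lenses_exceed l b b' z \<longleftrightarrow> (\<forall>c\<in>{b, b'}.
     l < card (crossings_on c \<inter> {lens_left b b' z..<z}) \<and>
     l < card (crossings_on c \<inter> {z..lens_right b b' z}))"

definition wide_pairs ::
    "nat \<Rightarrow> nat \<Rightarrow> nat \<Rightarrow> (((real \<Rightarrow> real) \<times> real \<times> real) \<times> ((real \<Rightarrow> real) \<times> real \<times> real)) set" where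
  "wide_pairs l L U = {((b, u, v), (b', u', v')). ((b, u, v), (b', u', v')) \<in> linked_pairs L U \<and>
     half_lenses_exceed l b b' (apex b u v)}"

text \<open>A linked pair that is not wide has a short left or right half along \<open>b\<close> or
  along \<open>b'\<close>. Exchanging the arches reduces \<open>b'\<close> to \<open>b\<close>, and
  each of the four cases contributes at most \<open>l * card (arches L U)\<close>.\<close>

lemma card_linked_pairs_le:
  "card (linked_pairs L U) \<le> card (wide_pairs l L U) + 4 * l * card (arches L U)"
proof -
  define B1 where "B1 = {((b, u, v), (b', u', v')). ((b, u, v), (b', u', v')) \<in> linked_pairs L U \<and>
      card (crossings_on b \<inter> {lens_left b b' (apex b u v)..<apex b u v}) \<le> l}"
  define B2 where "B2 = {((b, u, v), (b', u', v')). ((b, u, v), (b', u', v')) \<in> linked_pairs L U \<and>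
      card (crossings_on b \<inter> {apex b u v..lens_right b b' (apex b u v)}) \<le> l}"
  have c: "card B1 \<le> l * card (arches L U)" "card B2 \<le> l * card (arches L U)"
    using card_short_left_le card_short_right_le by (auto simp: B1_def B2_def)
  have fin: "finite B1" "finite B2" "finite (wide_pairs l L U)"
    by (rule finite_subset[OF _ finite_linked_pairs[of L U]]; force simp: B1_def B2_def wide_pairs_def)+
  have "linked_pairs L U \<subseteq> wide_pairs l L U \<union> (B1 \<union> B2 \<union> (prod.swap ` B1 \<union> prod.swap ` B2))"
  proof (rule subsetI, rule ccontr)
    fix e assume e: "e \<in> linked_pairs L U"
      "e \<notin> wide_pairs l L U \<union> (B1 \<union> B2 \<union> (prod.swap ` B1 \<union> prod.swap ` B2))"
    obtain b u v b' u' v' where "e = ((b, u, v), (b', u', v'))" by (metis prod.exhaust)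
    with e have e: "((b, u, v), (b', u', v')) \<in> linked_pairs L U"
      "((b, u, v), (b', u', v')) \<notin> prod.swap ` B2" "((b, u, v), (b', u', v')) \<notin> prod.swap ` B1"
      "((b, u, v), (b', u', v')) \<notin> B2" "((b, u, v), (b', u', v')) \<notin> B1"
      "((b, u, v), (b', u', v')) \<notin> wide_pairs l L U" by auto
    have e': "((b', u', v'), (b, u, v)) \<in> linked_pairs L U" by (rule linked_pairs_swap[OF e(1)])
    have z: "apex b' u' v' = apex b u v" using e(1) by (simp add: linked_pairs_def linked_def)
    have "((b', u', v'), (b, u, v)) \<notin> B1" "((b', u', v'), (b, u, v)) \<notin> B2"
      using e(2,3) by (metis imageI swap_simp)+
    then have "l < card (crossings_on b' \<inter> {lens_left b b' (apex b u v)..<apex b u v})"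
      "l < card (crossings_on b' \<inter> {apex b u v..lens_right b b' (apex b u v)})"
      using e' unfolding B1_def B2_def by (simp_all add: z lens_commute[of b' b])
    moreover have "l < card (crossings_on b \<inter> {lens_left b b' (apex b u v)..<apex b u v})"
      "l < card (crossings_on b \<inter> {apex b u v..lens_right b b' (apex b u v)})"
      using e(1,4,5) unfolding B1_def B2_def by simp_all
    ultimately have "half_lenses_exceed l b b' (apex b u v)" by (simp add: half_lenses_exceed_def)
    then show False using e by (simp add: wide_pairs_def)
  qed
  then have "card (linked_pairs L U)
      \<le> card (wide_pairs l L U \<union> (B1 \<union> B2 \<union> (prod.swap ` B1 \<union> prod.swap ` B2)))"
    by (rule card_mono[rotated]) (use fin in auto)
  also have "\<dots> \<le> card (wide_pairs l L U) + (card B1 + card B2 + (card B1 + card B2))"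
    by (intro card_Un_le[THEN order_trans] add_mono card_image_le fin order_refl)
  finally show ?thesis using c by simp
qed

definition charge ::
    "((real \<Rightarrow> real) \<times> real \<times> real) \<times> ((real \<Rightarrow> real) \<times> real \<times> real) \<Rightarrow> (real \<Rightarrow> real) \<times> real" where
  "charge = (\<lambda>((b, u, v), (b', u', v')). (b, lens_left b b' (apex b u v)))"

definition charged :: "nat \<Rightarrow> nat \<Rightarrow> nat \<Rightarrow> ((real \<Rightarrow> real) \<times> real) set" where
  "charged l L U = charge ` wide_pairs l L U"

lemma charged_subset: "charged l L U \<subseteq> crossing_incidences"
proof clarify
  fix b q assume "(b, q) \<in> charged l L U"
  then obtain u v b' u' v' where "linked b u v b' u' v'" "b \<noteq> b'" "q = lens_left b b' (apex b u v)"
    by (auto simp: charged_def charge_def wide_pairs_def linked_pairs_def)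
  then show "(b, q) \<in> crossing_incidences"
    using lens(7) by (auto simp: crossing_incidences_def linked_def arch_def)
qed

lemma finite_wide_pairs [simp]: "finite (wide_pairs l L U)"
  by (rule finite_subset[OF _ finite_linked_pairs[of L U]]) (auto simp: wide_pairs_def)

text \<open>A charge names \<open>b\<close> and the lens end \<open>q\<close>, and general position
  then gives \<open>b'\<close>. One of the two arches has \<open>q\<close> between its feet, so at
  most \<open>L\<^sup>2\<close> foot pairs are possible on each curve; that arch determines the
  other through the link.\<close>

lemma card_wide_pairs_le: "card (wide_pairs l L U) \<le> 2 * L\<^sup>2 * card (charged l L U)"
proof (rule card_le_fibre_bound[where f = charge])
  fix i assume "i \<in> charged l L U"
  then obtain b0 b1 q where i: "i = (b0, q)" and S: "b0 \<in> S" "b1 \<in> S" and ne: "b0 \<noteq> b1" and q: "b0 q = b1 q"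
  proof -
    obtain b u v b' u' v' where e: "i = (b, lens_left b b' (apex b u v))" "linked b u v b' u' v'" "b \<noteq> b'"
      using \<open>i \<in> charged l L U\<close> by (auto simp: charged_def charge_def wide_pairs_def linked_pairs_def)
    then show ?thesis using lens(3)[OF e(2,3)] that[of b _ b'] by (auto simp: linked_def arch_def)
  qed
  define sep where "sep b = {(u, v). (u, v) \<in> near_pairs (upper_touches b) L \<and> u \<le> q \<and> q < v}" for b
  have sep: "finite (sep b)" "card (sep b) \<le> L\<^sup>2" for b
    using card_near_pairs_separated_le[of "upper_touches b" L q]
    by (auto simp: sep_def intro: finite_subset[OF _ finite_near_pairs[of "upper_touches b" L]])
  let ?F = "{e\<in>wide_pairs l L U. charge e = i}"
  have F: "\<exists>u v u' v'. e = ((b0, u, v), (b1, u', v')) \<and> linked b0 u v b1 u' v' \<and>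
      ((u, v) \<in> sep b0 \<or> (u', v') \<in> sep b1)" if "e \<in> ?F" for e
  proof -
    obtain b u v b' u' v' where e: "e = ((b, u, v), (b', u', v'))" by (metis prod.exhaust)
    then have b: "b = b0" and q': "q = lens_left b0 b' (apex b0 u v)" using that i by (auto simp: charge_def)
    have l: "linked b0 u v b' u' v'" "b0 \<noteq> b'" "(b0, u, v) \<in> arches L U" "(b', u', v') \<in> arches L U"
      using that e b by (auto simp: wide_pairs_def linked_pairs_def)
    have "b' \<in> S" "b0 q = b' q" using l lens(3)[OF l(1,2)] q' by (auto simp: linked_def arch_def)
    then have b': "b' = b1" using no_three_concurrent[of b0 b1 b' q] S ne q l(2) by metis
    have z: "q < apex b0 u v" "apex b0 u v < v" "apex b0 u v < v'"
      using lens(1)[OF l(1,2)] q' apex(2)[of b0 u v] apex(2)[of b' u' v'] l(1) by (auto simp: linked_def)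
    have "(u, v) \<in> sep b0 \<or> (u', v') \<in> sep b1"
      using lens(5)[OF l(1,2)] q' z l(3,4) b' by (auto simp: sep_def arches_def)
    with e b b' l show ?thesis by auto
  qed
  have "card ?F \<le> card (Inl ` sep b0 \<union> Inr ` sep b1 :: (real \<times> real + real \<times> real) set)"
  proof (rule card_inj_on_le)
    \<comment> \<open>The feet on \<open>b0\<close> are recorded if they straddle \<open>q\<close>;
      otherwise the feet on \<open>b1\<close> are, which then must straddle \<open>q\<close>. The
      sum type keeps the cases apart.\<close>
    let ?h = "\<lambda>(d, d'). if snd d \<in> sep b0 then Inl (snd d) else Inr (snd d')"
    show "inj_on ?h ?F"
    proof (rule inj_onI)
      fix e1 e2 assume e: "e1 \<in> ?F" "e2 \<in> ?F" and h: "?h e1 = ?h e2"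
      obtain u1 v1 u1' v1' where e1: "e1 = ((b0, u1, v1), (b1, u1', v1'))" "linked b0 u1 v1 b1 u1' v1'"
        using F[OF e(1)] by blast
      obtain u2 v2 u2' v2' where e2: "e2 = ((b0, u2, v2), (b1, u2', v2'))" "linked b0 u2 v2 b1 u2' v2'"
        using F[OF e(2)] by blast
      have "(u1, v1) = (u2, v2) \<or> (u1', v1') = (u2', v2')"
        using h e1 e2 by (auto split: if_splits)
      \<comment> \<open>Equal feet on one curve give the same top curve and apex there, and the
        links carry both over to the other curve.\<close>
      then have "linked b0 u1 v1 b0 u2 v2 \<and> linked b1 u1' v1' b1 u2' v2'"
        using e1(2) e2(2) by (auto simp: linked_def)
      then show "e1 = e2" using linked_same_base e1 e2 by blast
    qed
    show "?h ` ?F \<subseteq> Inl ` sep b0 \<union> Inr ` sep b1" using F by fastforce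
  qed (use sep in auto)
  also have "\<dots> \<le> card (sep b0) + card (sep b1)"
    by (rule order_trans[OF card_Un_le add_mono]) (auto intro: card_image_le sep)
  also have "\<dots> \<le> 2 * L\<^sup>2" using sep(2)[of b0] sep(2)[of b1] by linarith
  finally show "card ?F \<le> 2 * L\<^sup>2" .
qed (simp_all add: charged_def)

text \<open>Let \<open>D\<close> be the number of arches. Collisions yield
  \<open>16 * l * D \<le> card (linked_pairs L U) + D\<close>, and at most \<open>4 * l * D\<close>
  linked pairs are not wide. So at least \<open>8 * l * D\<close> wide pairs remain, and each
  charged incidence absorbs at most \<open>2 * L\<^sup>2\<close> of them.\<close>

lemma card_charged_ge:
  assumes "L = 64 * \<kappa> * l" "U = 4 * \<kappa> * L" "\<kappa> > 0" "l > 0"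
    "2 * card S * L \<le> (\<Sum>b\<in>S. card (upper_touches b))"
    "card crossing_incidences \<le> \<kappa> * (\<Sum>b\<in>S. card (upper_touches b))"
  shows "(\<Sum>b\<in>S. card (upper_touches b)) \<le> 64 * \<kappa> * card (charged l L U)"
proof -
  define T where "T = (\<Sum>b\<in>S. card (upper_touches b))"
  define Y where "Y = card crossing_incidences"
  define D where "D = card (arches L U)"
  define W where "W = card (wide_pairs l L U)"
  have L: "L > 0" using assms by simp
  have TL: "T * L \<le> 4 * D" unfolding T_def D_def by (rule card_arches_ge) (use assms L in auto)
  have E: "card (linked_pairs L U) \<le> W + 4 * l * D" unfolding W_def D_def by (rule card_linked_pairs_le)
  \<comment> \<open>The factor \<open>64\<close> in \<open>L\<close> ensures that an incidence is
    the key of at least \<open>16 * l\<close> arches on average, well above the loss of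
    \<open>4 * l\<close> per arch.\<close>
  have "L * Y \<le> L * (\<kappa> * T)" using assms(6) by (simp add: T_def Y_def)
  also have "\<dots> \<le> \<kappa> * (4 * D)" using TL by (simp add: mult.commute mult.left_commute)
  finally have "(4 * \<kappa>) * (16 * l * Y) \<le> (4 * \<kappa>) * D" by (simp add: assms(1) algebra_simps)
  then have Y: "16 * l * Y \<le> D" using assms(3) by (simp add: algebra_simps)
  have "16 * l * D\<^sup>2 \<le> 16 * l * (Y * (card (linked_pairs L U) + D))"
    using card_arches_square_le[of L U] by (simp add: D_def Y_def)
  also have "\<dots> \<le> D * (card (linked_pairs L U) + D)"
    using mult_right_mono[OF Y, of "card (linked_pairs L U) + D"] by (simp add: mult.assoc)
  finally have "D * (16 * l * D) \<le> D * (card (linked_pairs L U) + D)"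
    by (simp add: power2_eq_square mult.assoc mult.left_commute)
  then have "16 * l * D \<le> card (linked_pairs L U) + D" by (cases "D = 0") auto
  then have "16 * (l * D) \<le> W + 4 * (l * D) + D" using E unfolding mult.assoc by linarith
  moreover have "D \<le> l * D" using assms(4) by simp
  ultimately have "8 * (l * D) \<le> W" by linarith
  also have "\<dots> \<le> 2 * L\<^sup>2 * card (charged l L U)" unfolding W_def by (rule card_wide_pairs_le)
  finally have "4 * (l * D) \<le> L\<^sup>2 * card (charged l L U)" by (simp add: mult.commute)
  moreover have "L * (l * T) = l * (T * L)" by (simp only: ac_simps)
  moreover have "l * (T * L) \<le> l * (4 * D)" using TL by (rule mult_le_mono2)
  ultimately have "L * (l * T) \<le> L * (L * card (charged l L U))"
    unfolding power2_eq_square mult.assoc by linarith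
  then have "l * T \<le> l * (64 * \<kappa> * card (charged l L U))" using L by (simp add: assms(1) algebra_simps)
  then show ?thesis using assms(4) by (simp add: T_def)
qed

section \<open>Separation of scales and the contradiction\<close>

text \<open>A common charge forces the same two curves and the same lens ends \<open>q\<close> and
  \<open>r\<close>, while the apexes \<open>z\<close> and \<open>w\<close> may differ. If
  \<open>w \<le> z\<close>, the left half of the lens at \<open>w\<close> lies inside an arch of the
  first scale, otherwise the right half does. That half has more than \<open>l' \<ge> U\<close>
  crossings, but the arch has at most \<open>U\<close>.\<close>

lemma charged_disjoint:
  assumes "U \<le> l'"
  shows "charged l L U \<inter> charged l' L' U' = {}"
proof (rule equals0I)
  fix i assume i: "i \<in> charged l L U \<inter> charged l' L' U'"
  obtain b q where bq: "i = (b, q)" by (cases i)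
  obtain u v b1 u1 v1 where 1: "((b, u, v), (b1, u1, v1)) \<in> wide_pairs l L U"
    "q = lens_left b b1 (apex b u v)" using i bq by (auto simp: charged_def charge_def)
  obtain s t b2 s2 t2 where 2: "((b, s, t), (b2, s2, t2)) \<in> wide_pairs l' L' U'"
    "q = lens_left b b2 (apex b s t)" using i bq by (auto simp: charged_def charge_def)
  have l1: "linked b u v b1 u1 v1" "b \<noteq> b1" "(b, u, v) \<in> arches L U" "(b1, u1, v1) \<in> arches L U"
    using 1 by (auto simp: wide_pairs_def linked_pairs_def)
  have l2: "linked b s t b2 s2 t2" "b \<noteq> b2" using 2 by (auto simp: wide_pairs_def linked_pairs_def)
  have "b q = b1 q" "b q = b2 q" using lens(3)[OF l1(1,2)] lens(3)[OF l2] 1 2 by auto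
  moreover have "b \<in> S" "b1 \<in> S" "b2 \<in> S" using l1 l2 by (auto simp: linked_def arch_def)
  ultimately have b2: "b2 = b1" using no_three_concurrent[of b b1 b2 q] l1(2) l2(2) by metis
  define z where "z = apex b u v"
  define w where "w = apex b s t"
  define r where "r = Min {x. q < x \<and> b x = b1 x}"
  have r: "lens_right b b1 z = r" "lens_right b b1 w = r"
    using lens(9)[OF l1(1,2)] lens(9)[OF l2] 1(2) 2(2) b2 by (auto simp: r_def z_def w_def)
  have z: "z < v" "z < v1" "u < z" "u1 < z" 
    using l1(1) apex(1,2)[of b u v] apex(1,2)[of b1 u1 v1] by (auto simp: linked_def z_def)
  have far: "U < card (crossings_on c \<inter> {q..<w})" "U < card (crossings_on c \<inter> {w..r})"
    if "c = b \<or> c = b1" for c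
    using 2 that assms r(2) b2 by (auto simp: wide_pairs_def half_lenses_exceed_def w_def)
  have near: "card (crossings_on b \<inter> {u..<v}) \<le> U" "card (crossings_on b1 \<inter> {u1..<v1}) \<le> U"
    using l1 by (auto simp: arches_def)
  have mono: "card (crossings_on c \<inter> A) \<le> card (crossings_on c \<inter> B)" if "A \<subseteq> B" for c and A B :: "real set"
    by (rule card_mono) (use that in auto)
  show False
  proof (cases "w \<le> z")
    case True
    have "u < q \<or> u1 < q" using lens(5)[OF l1(1,2)] 1(2) by auto
    then show False
    proof
      assume "u < q"
      then show False using mono[of "{q..<w}" "{u..<v}" b] far(1)[of b] near(1) True z by force
    next
      assume "u1 < q"
      then show False using mono[of "{q..<w}" "{u1..<v1}" b1] far(1)[of b1] near(2) True z by force
    qed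
  next
    case False
    have "r < v \<or> r < v1" using lens(6)[OF l1(1,2)] r(1) by (auto simp: z_def)
    then show False
    proof
      assume "r < v"
      then show False using mono[of "{w..r}" "{u..<v}" b] far(2)[of b] near(1) False z by force
    next
      assume "r < v1"
      then show False using mono[of "{w..r}" "{u1..<v1}" b1] far(2)[of b1] near(2) False z by force
    qed
  qed
qed

text \<open>Otherwise each of \<open>64 * \<kappa>\<^sup>2 + 1\<close> scales charges at least a
  fraction \<open>1 / (64 * \<kappa>)\<close> of the number of touchings, and these disjoint sets do
  not fit. The density hypothesis is the requirement \<open>2 * card S * L \<le> T\<close> at the
  largest scale.\<close>

lemma crossing_incidences_gt:
  assumes "\<kappa> > 0" "S \<noteq> {}"
    "128 * \<kappa> * (256 * \<kappa>\<^sup>2) ^ (64 * \<kappa>\<^sup>2) * card S \<le> (\<Sum>b\<in>S. card (upper_touches b))"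
  shows "\<kappa> * (\<Sum>b\<in>S. card (upper_touches b)) < card crossing_incidences"
proof (rule ccontr)
  assume "\<not> ?thesis"
  then have Y: "card crossing_incidences \<le> \<kappa> * (\<Sum>b\<in>S. card (upper_touches b))" by simp
  define T where "T = (\<Sum>b\<in>S. card (upper_touches b))"
  \<comment> \<open>The ratio \<open>256 * \<kappa>\<^sup>2 = 4 * \<kappa> * (64 * \<kappa>)\<close>
    makes the crossing bound \<open>U\<close> of one scale equal to the threshold of the
    next.\<close>
  define l where "l s = (256 * \<kappa>\<^sup>2) ^ s" for s :: nat
  define C where "C s = charged (l s) (64 * \<kappa> * l s) (4 * \<kappa> * (64 * \<kappa> * l s))" for s
  define N where "N = 64 * \<kappa>\<^sup>2"
  have l: "l s > 0" for s using assms(1) by (simp add: l_def)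
  have C: "T \<le> 64 * \<kappa> * card (C s)" if "s \<le> N" for s
    unfolding C_def T_def
  proof (rule card_charged_ge[OF refl refl assms(1) l _ Y])
    have "l s \<le> l N" unfolding l_def using assms(1) that by (intro power_increasing) auto
    then have "2 * card S * (64 * \<kappa> * l s) \<le> 2 * card S * (64 * \<kappa> * l N)" by simp
    also have "\<dots> \<le> T" using assms(3) by (simp add: T_def l_def N_def algebra_simps)
    finally show "2 * card S * (64 * \<kappa> * l s) \<le> (\<Sum>b\<in>S. card (upper_touches b))" by (simp add: T_def)
  qed
  have disj: "C s \<inter> C s' = {}" if "s < s'" for s s'
    unfolding C_def
  proof (rule charged_disjoint)
    have "4 * \<kappa> * (64 * \<kappa> * l s) = l (Suc s)" by (simp add: l_def power2_eq_square)
    also have "\<dots> \<le> l s'" unfolding l_def using assms(1) that by (intro power_increasing) auto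
    finally show "4 * \<kappa> * (64 * \<kappa> * l s) \<le> l s'" .
  qed
  have sub: "C s \<subseteq> crossing_incidences" for s unfolding C_def by (rule charged_subset)
  have "(\<Sum>s\<le>N. card (C s)) = card (\<Union>s\<le>N. C s)"
  proof (rule card_UN_disjoint[symmetric])
    show "\<forall>s\<in>{..N}. finite (C s)" using finite_subset[OF sub] by simp
    show "\<forall>i\<in>{..N}. \<forall>j\<in>{..N}. i \<noteq> j \<longrightarrow> C i \<inter> C j = {}"
      using disj by (metis inf_commute linorder_neqE_nat)
  qed simp
  also have "\<dots> \<le> card crossing_incidences" using sub by (intro card_mono) auto
  also have "\<dots> \<le> \<kappa> * T" using Y by (simp add: T_def)
  finally have "64 * \<kappa> * (\<Sum>s\<le>N. card (C s)) \<le> 64 * \<kappa> * (\<kappa> * T)" by simp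
  moreover have "(\<Sum>s\<le>N. T) \<le> 64 * \<kappa> * (\<Sum>s\<le>N. card (C s))"
    unfolding sum_distrib_left by (intro sum_mono C) simp
  ultimately have "(\<Sum>s\<le>N. T) \<le> 64 * \<kappa> * (\<kappa> * T)" by (rule order_trans[rotated])
  \<comment> \<open>The scales \<open>0\<close> to \<open>N\<close> are one more than the assumed
    bound on incidences admits, unless \<open>T\<close> vanishes.\<close>
  then have "Suc N * T \<le> N * T"
    by (simp only: sum_constant card_atMost N_def power2_eq_square mult.assoc of_nat_id)
  then have "T = 0" by simp
  then show False using assms finite_S by (simp add: T_def)
qed

end

section \<open>Choice of \<open>\<kappa>\<close> and the asymptotic bound\<close>

text \<open>With \<open>w = sqrt (ln t / ln (ln t))\<close> and
  \<open>B = 256 * \<kappa>\<^sup>2 \<le> w\<^sup>2\<close>, the exponent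
  \<open>64 * \<kappa>\<^sup>2 + 1\<close> is at most \<open>B\<close>, so that power of
  \<open>B\<close> has logarithm at most \<open>w\<^sup>2 * ln (ln t) = ln t\<close>.\<close>

lemma exists_multiplicity_for_density:
  "\<exists>C>0. \<forall>t>C. \<exists>\<kappa>::nat. \<kappa> > 0 \<and>
     128 * real \<kappa> * (256 * (real \<kappa>)\<^sup>2) ^ (64 * \<kappa>\<^sup>2) \<le> t \<and>
     sqrt (ln t / ln (ln t)) / 64 \<le> real \<kappa> / 2"
proof -
  have "filterlim (\<lambda>t::real. sqrt (ln t / ln (ln t))) at_top at_top" by real_asymp
  then have "\<forall>\<^sub>F t::real in at_top. 32 \<le> sqrt (ln t / ln (ln t))" by (simp add: filterlim_at_top)
  moreover have "\<forall>\<^sub>F t::real in at_top. 1 \<le> ln (ln t)" by real_asymp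
  moreover have "\<forall>\<^sub>F t::real in at_top. 1 < ln t" by real_asymp
  ultimately have "\<forall>\<^sub>F t::real in at_top. 32 \<le> sqrt (ln t / ln (ln t)) \<and> 1 \<le> ln (ln t) \<and> 1 < ln t"
    by eventually_elim simp
  then obtain C0 where C0: "\<And>t::real. C0 \<le> t \<Longrightarrow> 32 \<le> sqrt (ln t / ln (ln t)) \<and> 1 \<le> ln (ln t) \<and> 1 < ln t"
    by (auto simp: eventually_at_top_linorder)
  have "\<exists>\<kappa>::nat. \<kappa> > 0 \<and> 128 * real \<kappa> * (256 * (real \<kappa>)\<^sup>2) ^ (64 * \<kappa>\<^sup>2) \<le> t \<and>
     sqrt (ln t / ln (ln t)) / 64 \<le> real \<kappa> / 2" if "max C0 1 < t" for t :: real
  proof -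
    define w where "w = sqrt (ln t / ln (ln t))"
    \<comment> \<open>The divisor \<open>16\<close> gives
      \<open>256 * \<kappa>\<^sup>2 \<le> w\<^sup>2\<close>; as \<open>w \<ge> 32\<close>, rounding
      down still leaves at least \<open>w / 32\<close>.\<close>
    define \<kappa> where "\<kappa> = nat \<lfloor>w / 16\<rfloor>"
    have t: "t > 1" "32 \<le> w" "1 \<le> ln (ln t)" "1 < ln t" using that C0[of t] by (auto simp: w_def)
    have "0 \<le> ln t / ln (ln t)" by (intro divide_nonneg_nonneg) (use t in auto)
    then have w2: "w\<^sup>2 = ln t / ln (ln t)" by (simp add: w_def)
    have k: "real \<kappa> \<le> w / 16" "w / 16 - 1 < real \<kappa>" using t unfolding \<kappa>_def by linarith+
    then have k1: "1 \<le> real \<kappa>" "w / 32 \<le> real \<kappa>" using t by linarith+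
    define B where "B = 256 * (real \<kappa>)\<^sup>2"
    have kk: "1 * real \<kappa> \<le> (real \<kappa>)\<^sup>2" "1 \<le> (real \<kappa>)\<^sup>2"
      unfolding power2_eq_square using k1 by (intro mult_right_mono, auto simp: mult_ge1_I)
    have B_ge: "256 \<le> B" using kk(2) unfolding B_def by linarith
    have "(16 * real \<kappa>)\<^sup>2 \<le> w\<^sup>2" using k k1 by (intro power_mono) auto
    then have B: "B \<le> ln t / ln (ln t)" unfolding w2[symmetric] by (simp add: B_def power_mult_distrib)
    also have "\<dots> \<le> ln t / 1" using t by (intro divide_left_mono) auto
    finally have "ln B \<le> ln (ln t)" using B_ge t by (subst ln_le_cancel_iff) auto
    moreover have "real (Suc (64 * \<kappa>\<^sup>2)) \<le> ln t / ln (ln t)" using B kk by (simp add: B_def)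
    ultimately have "real (Suc (64 * \<kappa>\<^sup>2)) * ln B \<le> (ln t / ln (ln t)) * ln (ln t)"
      using B_ge t by (intro mult_mono) auto
    moreover have "ln (B ^ Suc (64 * \<kappa>\<^sup>2)) = real (Suc (64 * \<kappa>\<^sup>2)) * ln B"
      by (rule ln_realpow)
    moreover have "(ln t / ln (ln t)) * ln (ln t) = ln t" using t by simp
    ultimately have "ln (B ^ Suc (64 * \<kappa>\<^sup>2)) \<le> ln t" by linarith
    then have "B ^ Suc (64 * \<kappa>\<^sup>2) \<le> t"
      using B_ge t by (subst (asm) ln_le_cancel_iff) auto
    \<comment> \<open>The extra factor \<open>B\<close> in the power bounded by \<open>t\<close>
      absorbs \<open>128 * \<kappa>\<close>.\<close>
    moreover have "128 * real \<kappa> * B ^ (64 * \<kappa>\<^sup>2) \<le> B * B ^ (64 * \<kappa>\<^sup>2)"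
    proof (rule mult_right_mono)
      show "128 * real \<kappa> \<le> B" using kk unfolding B_def by linarith
    qed (use B_ge in simp)
    ultimately have "128 * real \<kappa> * B ^ (64 * \<kappa>\<^sup>2) \<le> t" by simp
    then show ?thesis using k1 by (intro exI[of _ \<kappa>]) (auto simp: B_def w_def)
  qed
  then show ?thesis by (intro exI[of _ "max C0 1"]) auto
qed

theorem corollary4:
  "\<exists>C>0. \<exists>c>0. \<forall>(S :: (real \<Rightarrow> real) set) (n :: nat) (t :: real).
     finite S \<and> card S = n \<and> (\<forall>f\<in>S. continuous_on UNIV f) \<and> general_position S \<and>
     real (card (touching_pairs S)) = t * real n \<and> t > C \<longrightarrow>
     real (card (crossing_points S)) \<ge> c * (real n * t * sqrt (ln t / ln (ln t)))"
proof -
  obtain C :: real where C: "C > 0" "\<And>t. t > C \<Longrightarrow> \<exists>\<kappa>::nat. \<kappa> > 0 \<and>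
     128 * real \<kappa> * (256 * (real \<kappa>)\<^sup>2) ^ (64 * \<kappa>\<^sup>2) \<le> t \<and>
     sqrt (ln t / ln (ln t)) / 64 \<le> real \<kappa> / 2"
    using exists_multiplicity_for_density by blast
  have "1 / 64 * (real n * t * sqrt (ln t / ln (ln t))) \<le> real (card (crossing_points S))"
    if S: "finite S" "card S = n" "\<forall>f\<in>S. continuous_on UNIV f" "general_position S"
      and T: "real (card (touching_pairs S)) = t * real n" and t: "t > C"
    for S :: "(real \<Rightarrow> real) set" and n t
  proof (cases "n = 0")
    case False
    interpret curve_family S by unfold_locales (use S in auto)
    obtain \<kappa> :: nat where k: "\<kappa> > 0" "128 * real \<kappa> * (256 * (real \<kappa>)\<^sup>2) ^ (64 * \<kappa>\<^sup>2) \<le> t"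
      "sqrt (ln t / ln (ln t)) / 64 \<le> real \<kappa> / 2" using C(2)[OF t] by blast
    define M where "M = (\<Sum>b\<in>S. card (upper_touches b))"
    have M: "t * real n \<le> real M"
      using card_touching_pairs_le unfolding T[symmetric] M_def by (simp only: of_nat_le_iff)
    have "real (128 * \<kappa> * (256 * \<kappa>\<^sup>2) ^ (64 * \<kappa>\<^sup>2) * card S) \<le> t * real n"
      using mult_right_mono[OF k(2), of "real n"] S(2) by simp
    also note M
    finally have "128 * \<kappa> * (256 * \<kappa>\<^sup>2) ^ (64 * \<kappa>\<^sup>2) * card S \<le> M" by (simp only: of_nat_le_iff)
    then have "\<kappa> * M < card crossing_incidences"
      unfolding M_def using k(1) S(2) False by (intro crossing_incidences_gt) auto
    \<comment> \<open>Two incidences per crossing point leave a factor \<open>\<kappa> / 2\<close>;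
      with \<open>\<kappa> \<ge> sqrt (ln t / ln (ln t)) / 32\<close> this produces the constant
      \<open>1 / 64\<close>.\<close>
    then have "\<kappa> * M \<le> 2 * card (crossing_points S)" using card_crossing_incidences_le by linarith
    then have X: "real \<kappa> * real M \<le> 2 * real (card (crossing_points S))"
      by (metis of_nat_le_iff of_nat_mult of_nat_numeral)
    have "1 / 64 * (real n * t * sqrt (ln t / ln (ln t))) = (t * real n) * (sqrt (ln t / ln (ln t)) / 64)"
      by simp
    also have "\<dots> \<le> (t * real n) * (real \<kappa> / 2)"
      using k(3) t C(1) by (intro mult_left_mono) auto
    also have "\<dots> \<le> real M * (real \<kappa> / 2)" using M by (intro mult_right_mono) auto
    also have "\<dots> \<le> real (card (crossing_points S))" using X by (simp add: mult.commute)
    finally show ?thesis .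
  qed simp
  then show ?thesis using C(1) by (intro exI[of _ C] conjI exI[of _ "1 / 64 :: real"]) auto
qed

end
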